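(* For every integer $k\geq 2$ there exists a finite family $\mathcal{C}$ of grounded $x$-monotone curves such that its disjointness graph $G$ satisfies $\omega(G)=k$ and $\chi(G)=\binom{k+1}{2}$.
   Context: A curve is the image of a continuous map $\phi:[0,1]\to\mathbb{R}^2$. A curve is $x$-monotone if every vertical line meets it in at most one point. A grounded $x$-monotone curve is an $x$-monotone curve contained in the half-plane $\{x\geq 0\}$ whose left endpoint lies on the line $\{x=0\}$. The disjointness graph of a family of curves has the curves as vertices, two vertices being adjacent if and only if the corresponding curves are disjoint. $\omega$ and $\chi$ denote clique number and chromatic number. *)

theory Defs
  imports "HOL-Analysis.Analysis" "HOL-Library.Ramsey"
begin

definition curve :: "(real \<times> real) set \<Rightarrow> bool" where
  "curve C \<longleftrightarrow> (\<exists>\<phi>. path \<phi> \<and> C = path_image \<phi>)"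

definition vertical_line :: "real \<Rightarrow> (real \<times> real) set" where
  "vertical_line x = {p. fst p = x}"

definition x_monotone_curve :: "(real \<times> real) set \<Rightarrow> bool" where
  "x_monotone_curve C \<longleftrightarrow> curve C \<and> (\<forall>x. \<exists>\<^sub>\<le>\<^sub>1 p. p \<in> C \<inter> vertical_line x)"

text \<open>The left endpoint is the point of least abscissa. It exists and is unique for every
  \<open>x\<close>-monotone curve. A single point counts as a curve, its left endpoint being that point.\<close>

definition is_left_endpoint :: "real \<times> real \<Rightarrow> (real \<times> real) set \<Rightarrow> bool" where
  "is_left_endpoint p C \<longleftrightarrow> p \<in> C \<and> (\<forall>q\<in>C. fst p \<le> fst q)"

definition grounded_x_monotone_curve :: "(real \<times> real) set \<Rightarrow> bool" where
  "grounded_x_monotone_curve C \<longleftrightarrow>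
     x_monotone_curve C \<and> C \<subseteq> {p. fst p \<ge> 0} \<and>
     (\<exists>p. is_left_endpoint p C \<and> p \<in> vertical_line 0)"

text \<open>A graph is given by its vertex set and its set of two-element edges, as in the predicate
  \<^const>\<open>clique\<close> of \<^theory>\<open>HOL-Library.Ramsey\<close>.\<close>

definition disjointness_edges :: "'a set set \<Rightarrow> 'a set set set" where
  "disjointness_edges \<C> = {{A, B} |A B. A \<in> \<C> \<and> B \<in> \<C> \<and> A \<noteq> B \<and> disjnt A B}"

text \<open>The following two numbers are meaningful for finite vertex sets only.\<close>

definition clique_number :: "'v set \<Rightarrow> 'v set set \<Rightarrow> nat" where
  "clique_number V E = Max {card K |K. K \<subseteq> V \<and> clique K E}"

definition proper_colouring :: "'v set \<Rightarrow> 'v set set \<Rightarrow> ('v \<Rightarrow> 'c) \<Rightarrow> bool" where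
  "proper_colouring V E c \<longleftrightarrow> (\<forall>u\<in>V. \<forall>v\<in>V. {u, v} \<in> E \<longrightarrow> c u \<noteq> c v)"

definition chromatic_number :: "'v set \<Rightarrow> 'v set set \<Rightarrow> nat" where
  "chromatic_number V E = (LEAST n. \<exists>c :: 'v \<Rightarrow> nat. c ` V \<subseteq> {..<n} \<and> proper_colouring V E c)"

end

theory Submission
  imports Defs
begin

text \<open>If three curves \<open>a\<close>, \<open>b\<close>, \<open>c\<close> start in this order from bottom to top, and \<open>b\<close> is disjoint from
  \<open>a\<close> and \<open>c\<close>, then \<open>a\<close> and \<open>c\<close> are disjoint unless \<open>b\<close> is shorter than both. Conversely, every finite
  acyclic digraph with this property comes from curves: let the curves end one after the other, and let
  each, just before its end, cross all longer curves that it has to meet.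

  Such digraphs with clique number \<open>k\<close> and chromatic number \<open>k + 1 choose 2\<close> arise inductively. Take
  \<open>k + 1\<close> cliques of size \<open>k + 1\<close> and, for each transversal of them, a new copy of the digraph for \<open>k\<close>
  joined to the transversal. A clique that meets a copy has at most one vertex outside of it. In every
  proper colouring some transversal is rainbow, and its \<open>k + 1\<close> colours are missing from its copy.\<close>

section \<open>Realising a digraph by curves\<close>

text \<open>Tent of height 1 on \<open>[-1, 1]\<close>. Among the integers it is nonzero at 0 only,
  so a sum of tents centred at integers takes prescribed values there.\<close>

definition hat :: "real \<Rightarrow> real" where
  "hat z = max 0 (1 - \<bar>z\<bar>)"

lemma hat_nonneg: "0 \<le> hat z"
  by (simp add: hat_def)

lemma hat_eq_0: "1 \<le> \<bar>z\<bar> \<Longrightarrow> hat z = 0"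
  by (simp add: hat_def)

lemma hat_of_int: "hat (of_int n) = (if n = 0 then 1 else 0)"
  by (auto simp: hat_def max_def simp flip: of_int_abs)

lemma continuous_on_hat [continuous_intros]:
  "continuous_on S f \<Longrightarrow> continuous_on S (\<lambda>x. hat (f x))"
  unfolding hat_def by (intro continuous_intros)

section \<open>Function graphs as grounded curves\<close>

definition graph_curve :: "(real \<Rightarrow> real) \<Rightarrow> real \<Rightarrow> (real \<times> real) set" where
  "graph_curve f L = (\<lambda>x. (x, f x)) ` {0..L}"

lemma grounded_graph_curve:
  assumes "continuous_on {0..L} f" "0 \<le> L"
  shows "grounded_x_monotone_curve (graph_curve f L)"
proof -
  have im: "(\<lambda>t. L * t) ` {0..1} = {0..L}"
    using assms(2) by (simp add: image_mult_atLeastAtMost_if)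
  let ?\<phi> = "(\<lambda>x. (x, f x)) \<circ> (\<lambda>t. L * t)"
  have "path ?\<phi>"
    unfolding path_def
    by (rule continuous_on_compose) (use assms(1) im in \<open>auto intro!: continuous_intros\<close>)
  moreover have "graph_curve f L = path_image ?\<phi>"
    unfolding path_image_def graph_curve_def image_comp [symmetric] im ..
  ultimately have "curve (graph_curve f L)"
    unfolding curve_def by blast
  moreover have "is_left_endpoint (0, f 0) (graph_curve f L)"
    using assms(2) by (auto simp: is_left_endpoint_def graph_curve_def)
  ultimately show ?thesis
    unfolding grounded_x_monotone_curve_def x_monotone_curve_def
    by (intro conjI exI[of _ "(0, f 0)"])
       (auto simp: Uniq_def graph_curve_def vertical_line_def)
qed

text \<open>The projection to the first axis is \<open>{0..L}\<close>. Curves of different lengths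
  are thus different.\<close>

lemma graph_curve_inj:
  assumes "graph_curve f L = graph_curve g M" "0 \<le> L" "0 \<le> M"
  shows "L = M"
proof -
  have "fst ` graph_curve f L = {0..L}" for f :: "real \<Rightarrow> real" and L
    by (simp add: graph_curve_def image_image)
  then have "{0..L} = {0..M}"
    using assms(1) by metis
  then show ?thesis
    using assms(2,3) by simp
qed

lemma disjnt_graph_curve:
  "disjnt (graph_curve f L) (graph_curve g M) \<longleftrightarrow> (\<forall>x\<in>{0..min L M}. f x \<noteq> g x)"
  by (fastforce simp: disjnt_iff graph_curve_def)

text \<open>Intermediate value theorem for \<open>f - g\<close> on \<open>{0..x}\<close>, where both
  curves are still alive.\<close>

lemma not_disjnt_graph_curveI:
  assumes cont: "continuous_on UNIV f" "continuous_on UNIV g"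
    and x: "0 \<le> x" "x \<le> L" "x \<le> M"
    and cross: "f 0 \<le> g 0 \<and> g x \<le> f x \<or> g 0 \<le> f 0 \<and> f x \<le> g x"
  shows "\<not> disjnt (graph_curve f L) (graph_curve g M)"
proof -
  have "continuous_on {0..x} (\<lambda>y. f y - g y)"
    using cont by (intro continuous_intros) (auto intro: continuous_on_subset)
  then obtain y where "0 \<le> y" "y \<le> x" "f y - g y = 0"
    using cross IVT'[of "\<lambda>y. f y - g y" 0 0 x] IVT2'[of "\<lambda>y. f y - g y" x 0 0] x(1)
    by auto
  then show ?thesis
    using x unfolding disjnt_graph_curve by (auto intro!: bexI[of _ y])
qed

text \<open>The curve of \<open>v\<close> ends at abscissa \<open>2 * r v + 2\<close>. Just before its end, it sweeps upwards and
  then downwards through the curves that are still alive, except for its neighbours, which are moved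
  out of the way.\<close>

definition sweep :: "'a set \<Rightarrow> ('a \<Rightarrow> 'a \<Rightarrow> bool) \<Rightarrow> ('a \<Rightarrow> nat) \<Rightarrow> ('a \<Rightarrow> nat) \<Rightarrow> real \<Rightarrow> 'a \<Rightarrow> real \<Rightarrow> real"
  where "sweep V E r pos M v x =
    real (pos v)
    + M * (\<Sum>c\<in>V. (if E c v then 2 else if v = c then 1 else 0) * hat (x - (2 * real (r c) + 1)))
    - M * (\<Sum>c\<in>V. (if E v c then 2 else if v = c then 1 else 0) * hat (x - (2 * real (r c) + 2)))"

text \<open>\<open>E a b\<close> stands for disjoint curves with \<open>a\<close> below
  \<open>b\<close>; \<open>r\<close> is the order in which the curves end.\<close>

locale sweepable =
  fixes V :: "'a set" and E :: "'a \<Rightarrow> 'a \<Rightarrow> bool" and r pos :: "'a \<Rightarrow> nat"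
  assumes fin: "finite V"
    and inj_r: "inj_on r V"
    and pos: "\<And>a b. a \<in> V \<Longrightarrow> b \<in> V \<Longrightarrow> E a b \<Longrightarrow> pos a < pos b"
    and trans_or: "\<And>a b c. a \<in> V \<Longrightarrow> b \<in> V \<Longrightarrow> c \<in> V \<Longrightarrow> E a b \<Longrightarrow> E b c \<Longrightarrow>
      E a c \<or> r b < r a \<and> r b < r c"
begin

text \<open>A crude bound for all starting heights, hence a swing large enough to pass any other
  starting height. A sum, unlike a maximum, is harmless for empty \<open>V\<close>.\<close>

definition height :: real where
  "height = real (\<Sum>v\<in>V. pos v)"

lemma pos_le_height: "v \<in> V \<Longrightarrow> real (pos v) \<le> height"
  unfolding height_def of_nat_le_iff by (rule member_le_sum) (use fin in auto)

definition sweep_curve :: "'a \<Rightarrow> (real \<times> real) set" where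
  "sweep_curve v = graph_curve (sweep V E r pos height v) (2 * real (r v) + 2)"

lemma continuous_sweep: "continuous_on S (sweep V E r pos M v)"
  unfolding sweep_def by (intro continuous_intros)

lemma grounded_sweep_curve: "grounded_x_monotone_curve (sweep_curve v)"
  unfolding sweep_curve_def by (intro grounded_graph_curve continuous_sweep) auto

lemma inj_sweep_curve: "inj_on sweep_curve V"
  unfolding sweep_curve_def
  by (rule inj_onI) (use inj_r in \<open>force dest!: graph_curve_inj dest: inj_onD\<close>)

lemma sweep_0: "sweep V E r pos M v 0 = pos v"
  unfolding sweep_def by (simp add: hat_eq_0)

lemma hat_diff_nat:
  "hat (real m - real n) = (if m = n then 1 else 0)"
  using hat_of_int[of "int m - int n"] by simp

text \<open>The tents are centred at distinct integers: parity separates upward from downward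
  sweeps, injectivity of \<open>r\<close> separates vertices. Only the upward tent of
  \<open>a\<close> is seen here.\<close>

lemma sweep_up:
  fixes M :: real
  assumes "a \<in> V"
  shows "sweep V E r pos M v (2 * real (r a) + 1) =
    pos v + M * (if E a v then 2 else if v = a then 1 else 0)"
proof -
  have 1: "hat (2 * real (r a) + 1 - (2 * real (r c) + 1)) = (if a = c then 1 else 0)"
    if "c \<in> V" for c
    using hat_diff_nat[of "2 * r a + 1" "2 * r c + 1"] inj_onD[OF inj_r, of a c] assms that
    by auto
  have 2: "hat (2 * real (r a) + 1 - (2 * real (r c) + 2)) = 0" for c
    using hat_diff_nat[of "2 * r a + 1" "2 * r c + 2"] by (simp split: if_splits) presburger
  have "(\<Sum>c\<in>V. (if E c v then 2 else if v = c then 1 else 0) * hat (2 * real (r a) + 1 - (2 * real (r c) + 1)))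
      = (\<Sum>c\<in>V. if a = c then (if E c v then 2 else if v = c then 1 else 0) else 0)"
    by (intro sum.cong refl) (simp only: 1, auto)
  then show ?thesis
    unfolding sweep_def 2 using assms fin by (simp add: sum.delta)
qed

lemma sweep_down:
  fixes M :: real
  assumes "a \<in> V"
  shows "sweep V E r pos M v (2 * real (r a) + 2) =
    pos v - M * (if E v a then 2 else if v = a then 1 else 0)"
proof -
  have 1: "hat (2 * real (r a) + 2 - (2 * real (r c) + 2)) = (if a = c then 1 else 0)"
    if "c \<in> V" for c
    using hat_diff_nat[of "2 * r a + 2" "2 * r c + 2"] inj_onD[OF inj_r, of a c] assms that
    by auto
  have 2: "hat (2 * real (r a) + 2 - (2 * real (r c) + 1)) = 0" for c
    using hat_diff_nat[of "2 * r a + 2" "2 * r c + 1"] by (simp split: if_splits) presburger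
  have "(\<Sum>c\<in>V. (if E v c then 2 else if v = c then 1 else 0) * hat (2 * real (r a) + 2 - (2 * real (r c) + 2)))
      = (\<Sum>c\<in>V. if a = c then (if E v c then 2 else if v = c then 1 else 0) else 0)"
    by (intro sum.cong refl) (simp only: 1, auto)
  then show ?thesis
    unfolding sweep_def 2 using assms fin by (simp add: sum.delta)
qed

text \<open>The starts are strictly ordered and no tent spoils this. If \<open>c\<close> ends no
  later than \<open>a\<close> and \<open>b\<close>, then by \<open>trans_or\<close> it lifts
  \<open>b\<close> whenever it lifts \<open>a\<close>, and lowers \<open>a\<close> whenever it
  lowers \<open>b\<close>; otherwise its tents have not begun.\<close>

lemma sweep_less:
  assumes ab: "a \<in> V" "b \<in> V" "E a b"
    and x: "x \<le> 2 * real (r a) + 2" "x \<le> 2 * real (r b) + 2"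
  shows "sweep V E r pos height a x < sweep V E r pos height b x"
proof -
  \<comment> \<open>Ranks are integers, so \<open>x\<close> is at most \<open>2 * r c\<close>, where
    the first tent of \<open>c\<close> begins.\<close>
  have dead: "hat (x - (2 * real (r c) + 1)) = 0 \<and> hat (x - (2 * real (r c) + 2)) = 0"
    if "r a < r c \<or> r b < r c" for c
    using that x by (auto intro!: hat_eq_0)
  have up: "(\<Sum>c\<in>V. (if E c a then 2 else if a = c then 1 else 0) * hat (x - (2 * real (r c) + 1)))
      \<le> (\<Sum>c\<in>V. (if E c b then 2 else if b = c then 1 else 0) * hat (x - (2 * real (r c) + 1)))"
  proof (rule sum_mono)
    fix c assume c: "c \<in> V"
    show "(if E c a then 2 else if a = c then 1 else 0) * hat (x - (2 * real (r c) + 1))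
       \<le> (if E c b then 2 else if b = c then 1 else 0) * hat (x - (2 * real (r c) + 1))"
    proof (cases "r a < r c \<or> r b < r c")
      case False
      then have "E c a \<Longrightarrow> E c b"
        using trans_or[OF c ab(1,2)] ab(3) by auto
      then show ?thesis
        using ab(3) by (intro mult_right_mono hat_nonneg) auto
    qed (simp add: dead)
  qed
  have down: "(\<Sum>c\<in>V. (if E b c then 2 else if b = c then 1 else 0) * hat (x - (2 * real (r c) + 2)))
      \<le> (\<Sum>c\<in>V. (if E a c then 2 else if a = c then 1 else 0) * hat (x - (2 * real (r c) + 2)))"
  proof (rule sum_mono)
    fix c assume c: "c \<in> V"
    show "(if E b c then 2 else if b = c then 1 else 0) * hat (x - (2 * real (r c) + 2))
       \<le> (if E a c then 2 else if a = c then 1 else 0) * hat (x - (2 * real (r c) + 2))"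
    proof (cases "r a < r c \<or> r b < r c")
      case False
      then have "E b c \<Longrightarrow> E a c"
        using trans_or[OF ab(1,2) c] ab(3) by auto
      then show ?thesis
        using ab(3) by (intro mult_right_mono hat_nonneg) auto
    qed (simp add: dead)
  qed
  have "0 \<le> height"
    unfolding height_def by (rule of_nat_0_le_iff)
  from mult_left_mono[OF up this] mult_left_mono[OF down this] pos[OF ab]
  show ?thesis
    unfolding sweep_def by linarith
qed

text \<open>At the two peaks of the sweep of \<open>a\<close>, the curve of \<open>b\<close> is at
  its starting height. The upward peak reverses the order if \<open>a\<close> starts no higher than
  \<open>b\<close>, the downward peak otherwise.\<close>

lemma sweep_curves_meet:
  assumes ab: "a \<in> V" "b \<in> V" "a \<noteq> b" "\<not> E a b" "\<not> E b a" and r: "r a < r b"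
  shows "\<not> disjnt (sweep_curve a) (sweep_curve b)"
proof (cases "pos a \<le> pos b")
  case True
  have "sweep V E r pos height b (2 * real (r a) + 1) \<le> sweep V E r pos height a (2 * real (r a) + 1)"
    \<comment> \<open>\<open>pos\<close> at the pair \<open>a\<close>, \<open>a\<close> excludes a
      loop.\<close>
    using ab pos_le_height[OF ab(2)] pos[OF ab(1,1)] by (simp add: sweep_up)
  then show ?thesis
    unfolding sweep_curve_def using r True
    by (intro not_disjnt_graph_curveI[where x = "2 * real (r a) + 1"] continuous_sweep)
       (auto simp: sweep_0)
next
  case False
  have "sweep V E r pos height a (2 * real (r a) + 2) \<le> sweep V E r pos height b (2 * real (r a) + 2)"
    using ab pos_le_height[OF ab(1)] pos[OF ab(1,1)] by (simp add: sweep_down)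
  then show ?thesis
    unfolding sweep_curve_def using r False
    by (intro not_disjnt_graph_curveI[where x = "2 * real (r a) + 2"] continuous_sweep)
       (auto simp: sweep_0)
qed

lemma disjnt_sweep_curve:
  assumes "a \<in> V" "b \<in> V" "a \<noteq> b"
  shows "disjnt (sweep_curve a) (sweep_curve b) \<longleftrightarrow> E a b \<or> E b a"
proof
  assume "disjnt (sweep_curve a) (sweep_curve b)"
  moreover have "r a < r b \<or> r b < r a"
    using assms inj_onD[OF inj_r] by (meson linorder_neqE_nat)
  ultimately show "E a b \<or> E b a"
    using sweep_curves_meet[of a b] sweep_curves_meet[of b a] assms by (auto simp: disjnt_sym)
next
  assume "E a b \<or> E b a"
  then show "disjnt (sweep_curve a) (sweep_curve b)"
    using sweep_less[of a b] sweep_less[of b a] assms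
    by (fastforce simp: sweep_curve_def disjnt_graph_curve)
qed

end

section \<open>From digraphs to families of curves\<close>

lemma curves_of_digraph:
  fixes V :: "'a set" and pos len :: "'a \<Rightarrow> nat"
  assumes fin: "finite V"
    and pos: "\<And>a b. a \<in> V \<Longrightarrow> b \<in> V \<Longrightarrow> E a b \<Longrightarrow> pos a < pos b"
    and trans_or: "\<And>a b c. a \<in> V \<Longrightarrow> b \<in> V \<Longrightarrow> c \<in> V \<Longrightarrow> E a b \<Longrightarrow> E b c \<Longrightarrow>
      E a c \<or> len b < len a \<and> len b < len c"
  obtains F :: "'a \<Rightarrow> (real \<times> real) set"
  where "inj_on F V" "\<And>v. v \<in> V \<Longrightarrow> grounded_x_monotone_curve (F v)"
    "\<And>a b. a \<in> V \<Longrightarrow> b \<in> V \<Longrightarrow> a \<noteq> b \<Longrightarrow> disjnt (F a) (F b) \<longleftrightarrow> E a b \<or> E b a"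
proof -
  obtain e :: "'a \<Rightarrow> nat" and n where e: "e ` V = {i. i < n}" "inj_on e V"
    using finite_imp_inj_to_nat_seg[OF fin] by blast
  \<comment> \<open>Lexicographic: \<open>e v < n\<close> breaks ties of \<open>len\<close>, which
    makes \<open>r\<close> injective and keeps strict inequalities.\<close>
  define r where "r v = len v * n + e v" for v
  have less: "r a < r b" if "a \<in> V" "len a < len b" for a b
  proof -
    have "r a < Suc (len a) * n"
      using e(1) that(1) by (auto simp: r_def)
    also have "\<dots> \<le> len b * n"
      using that(2) by (intro mult_le_mono1) simp
    finally show ?thesis
      by (simp add: r_def)
  qed
  have "inj_on r V"
  proof (rule inj_onI)
    fix a b assume "a \<in> V" "b \<in> V" "r a = r b"
    moreover from this have "len a = len b"
      using less by (metis less_irrefl linorder_neqE_nat)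
    ultimately show "a = b"
      using inj_onD[OF e(2)] by (simp add: r_def)
  qed
  then interpret sweepable V E r pos
    using fin pos less by unfold_locales (blast dest: trans_or)+
  show thesis
    by (rule that[OF inj_sweep_curve grounded_sweep_curve disjnt_sweep_curve])
qed

text \<open>Injectivity turns distinctness of curves into distinctness of vertices.\<close>

lemma edge_disjointness_image:
  assumes "inj_on F V" "a \<in> V" "b \<in> V"
    and "\<And>a b. a \<in> V \<Longrightarrow> b \<in> V \<Longrightarrow> a \<noteq> b \<Longrightarrow> disjnt (F a) (F b) \<longleftrightarrow> E a b \<or> E b a"
  shows "{F a, F b} \<in> disjointness_edges (F ` V) \<longleftrightarrow> a \<noteq> b \<and> (E a b \<or> E b a)"
proof -
  have "{F a, F b} \<in> disjointness_edges (F ` V) \<longleftrightarrow> F a \<noteq> F b \<and> disjnt (F a) (F b)"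
    using assms(2,3) unfolding disjointness_edges_def
    by (auto simp: doubleton_eq_iff disjnt_sym)
  then show ?thesis
    using assms by (auto dest: inj_onD)
qed


section \<open>The digraphs\<close>

text \<open>\<open>Tip k i j\<close> is the \<open>j\<close>-th vertex of the \<open>i\<close>-th clique of level \<open>Suc k\<close>, and \<open>Copy g\<close> is the copy of
  level \<open>k\<close> that belongs to the transversal \<open>{Tip k i (g ! i) |i. i \<le> k}\<close>. The first index of
  \<open>Tip\<close> is there for \<open>len\<close> and \<open>colour\<close> only.\<close>

datatype vertex = Tip nat nat nat | Copy "nat list" vertex

definition choices :: "nat \<Rightarrow> nat list set" where
  "choices k = {g. length g = Suc k \<and> set g \<subseteq> {..k}}"

fun level :: "nat \<Rightarrow> vertex set" where
  "level 0 = {}"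
| "level (Suc k) = case_prod (Tip k) ` ({..k} \<times> {..k}) \<union> case_prod Copy ` (choices k \<times> level k)"

text \<open>Edges are oriented from bottom to top: by index inside a clique, and from a transversal
  to all of its copy. \<open>False\<close> only excludes the opposite direction.\<close>

fun joined :: "vertex \<Rightarrow> vertex \<Rightarrow> bool" where
  "joined (Tip k i j) (Tip k' i' j') \<longleftrightarrow> i = i' \<and> j < j'"
| "joined (Tip k i j) (Copy g x) \<longleftrightarrow> g ! i = j"
| "joined (Copy g x) (Tip k i j) \<longleftrightarrow> False"
| "joined (Copy g x) (Copy h y) \<longleftrightarrow> g = h \<and> joined x y"

text \<open>Lists in \<open>choices k\<close> have length \<open>k + 1\<close>, so the shift puts a
  copy above all tips of its level.\<close>

fun pos :: "vertex \<Rightarrow> nat" where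
  "pos (Tip k i j) = j"
| "pos (Copy g x) = length g + pos x"

text \<open>Inside a clique the higher curves are shorter, and copies outlive all tips.\<close>

fun len :: "vertex \<Rightarrow> nat" where
  "len (Tip k i j) = k - j"
| "len (Copy g x) = length g + len x"

text \<open>All cliques of level \<open>k + 1\<close> share the \<open>k + 1\<close> colours that
  follow those of level \<open>k\<close>.\<close>

fun colour :: "vertex \<Rightarrow> nat" where
  "colour (Tip k i j) = (Suc k choose 2) + j"
| "colour (Copy g x) = colour x"

section \<open>Orders, colours and cliques of the levels\<close>

lemma Suc_choose_2: "Suc k choose 2 = (k choose 2) + k"
  by (simp add: numeral_2_eq_2)

lemma in_level_Suc [simp]:
  "Tip m i j \<in> level (Suc k) \<longleftrightarrow> m = k \<and> i \<le> k \<and> j \<le> k"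
  "Copy g x \<in> level (Suc k) \<longleftrightarrow> g \<in> choices k \<and> x \<in> level k"
  by auto

lemma length_choices: "g \<in> choices k \<Longrightarrow> length g = Suc k"
  by (simp add: choices_def)

lemma finite_level: "finite (level k)"
proof (induction k)
  case (Suc k)
  have "finite (choices k)"
    using finite_lists_length_eq[of "{..k}" "Suc k"] by (simp add: choices_def conj_commute)
  with Suc show ?case
    by simp
qed simp

declare level.simps(2) [simp del]

lemma joined_pos: "a \<in> level k \<Longrightarrow> b \<in> level k \<Longrightarrow> joined a b \<Longrightarrow> pos a < pos b"
proof (induction k arbitrary: a b)
  case (Suc k)
  then show ?case
    by (cases a; cases b) (auto simp: length_choices)
qed simp

text \<open>At the top level transitivity fails only for \<open>Tip k i j\<close>,
  \<open>Tip k i (g ! i)\<close>, \<open>Copy g x\<close> with \<open>j < g ! i\<close>, and there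
  the middle vertex is the shortest. Three vertices of one copy are left to induction.\<close>

lemma joined_trans_or:
  "a \<in> level k \<Longrightarrow> b \<in> level k \<Longrightarrow> c \<in> level k \<Longrightarrow> joined a b \<Longrightarrow> joined b c \<Longrightarrow>
    joined a c \<or> len b < len a \<and> len b < len c"
proof (induction k arbitrary: a b c)
  case (Suc k)
  show ?case
  proof (cases "\<exists>g x h y. a = Copy g x \<and> b = Copy h y")
    case True
    with Suc.prems Suc.IH show ?thesis
      by (cases c) (auto, blast+)
  next
    case False
    with Suc.prems show ?thesis
      by (cases a; cases b; cases c) (auto simp: length_choices)
  qed
qed simp

lemma colour_less: "a \<in> level k \<Longrightarrow> colour a < Suc k choose 2"
proof (induction k arbitrary: a)
  case (Suc k)
  then show ?case
    by (cases a) (auto simp: Suc_choose_2[of "Suc k"] intro: less_SucI trans_less_add1)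
qed simp

lemma joined_colour: "a \<in> level k \<Longrightarrow> b \<in> level k \<Longrightarrow> joined a b \<Longrightarrow> colour a \<noteq> colour b"
proof (induction k arbitrary: a b)
  case (Suc k)
  then show ?case
    by (cases a; cases b) (auto dest: colour_less)
qed simp

text \<open>Tips with different \<open>i\<close> are not joined, nor are copies with different
  \<open>g\<close>. So a clique consists of tips with one \<open>i\<close>, or it lies in one copy
  up to a single tip \<open>Tip k i (g ! i)\<close>.\<close>

lemma clique_level_card_le:
  assumes "K \<subseteq> level k" "\<And>a b. a \<in> K \<Longrightarrow> b \<in> K \<Longrightarrow> a \<noteq> b \<Longrightarrow> joined a b \<or> joined b a"
  shows "card K \<le> k"
  using assms
proof (induction k arbitrary: K)
  case (Suc k)
  note adj = Suc.prems(2)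
  have fin: "finite K"
    using Suc.prems(1) finite_level finite_subset by blast
  have same: "i = i'" if "Tip k i j \<in> K" "Tip k i' j' \<in> K" for i j i' j'
    using adj[OF that] by auto
  show ?case
  proof (cases "\<exists>g x. Copy g x \<in> K")
    case False
    have tip: "\<exists>i j. v = Tip k i j \<and> j \<le> k" if "v \<in> K" for v
      using subsetD[OF Suc.prems(1) that] False that by (cases v) auto
    have "\<exists>i. K \<subseteq> Tip k i ` {..k}"
    proof (cases "K = {}")
      case False
      then obtain i j where "Tip k i j \<in> K"
        using tip by blast
      then have "K \<subseteq> Tip k i ` {..k}"
        using tip same by blast
      then show ?thesis ..
    qed simp
    then obtain i where "K \<subseteq> Tip k i ` {..k}" ..
    then have "card K \<le> card (Tip k i ` {..k})"
      by (intro card_mono) auto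
    also have "\<dots> = Suc k"
      by (simp add: card_image inj_on_def)
    finally show ?thesis .
  next
    case True
    then obtain g x where gx: "Copy g x \<in> K"
      by blast
    have copy: "h = g \<and> y \<in> level k" if "Copy h y \<in> K" for h y
      using adj[OF that gx] Suc.prems(1) that by auto
    define T where "T = {v \<in> K. \<exists>i j. v = Tip k i j}"
    define K' where "K' = {y. Copy g y \<in> K}"
    have "K' \<subseteq> level k"
      using copy by (auto simp: K'_def)
    moreover have "joined a b \<or> joined b a" if "a \<in> K'" "b \<in> K'" "a \<noteq> b" for a b
      using adj[of "Copy g a" "Copy g b"] that by (auto simp: K'_def)
    ultimately have "card K' \<le> k"
      by (rule Suc.IH)
    moreover have "card T \<le> 1"
    proof (rule card_le_Suc0_iff_eq[THEN iffD2, folded One_nat_def])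
      show "finite T"
        using fin by (simp add: T_def)
      have chosen: "\<exists>i. v = Tip k i (g ! i) \<and> v \<in> K" if "v \<in> T" for v
        using that adj[OF _ gx, of v] by (auto simp: T_def)
      show "\<forall>u\<in>T. \<forall>v\<in>T. u = v"
        using chosen same by metis
    qed
    moreover have "card K \<le> card T + card (Copy g ` K')"
    proof -
      have "v \<in> T \<union> Copy g ` K'" if "v \<in> K" for v
      proof (cases v)
        case (Copy h y)
        then show ?thesis
          using copy[of h y] that by (simp add: K'_def)
      qed (use subsetD[OF Suc.prems(1) that] that in \<open>simp add: T_def\<close>)
      moreover have "T \<union> Copy g ` K' \<subseteq> K"
        by (auto simp: T_def K'_def)
      ultimately have "K = T \<union> Copy g ` K'"
        by blast
      then show ?thesis
        using card_Un_le[of T "Copy g ` K'"] by simp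
    qed
    moreover have "card (Copy g ` K') = card K'"
      by (simp add: card_image inj_on_def)
    ultimately show ?thesis
      by linarith
  qed
qed simp

lemma clique_level_exists:
  "\<exists>K\<subseteq>level k. card K = k \<and> (\<forall>a\<in>K. \<forall>b\<in>K. a \<noteq> b \<longrightarrow> joined a b \<or> joined b a)"
proof (cases k)
  case (Suc m)
  then show ?thesis
    by (intro exI[of _ "Tip m 0 ` {..m}"]) (auto simp: card_image inj_on_def)
qed simp

text \<open>Greedy choice: the \<open>n\<close>-th row takes \<open>Suc k\<close> values, and fewer than that are already used.\<close>

lemma rainbow_transversal:
  fixes c :: "nat \<Rightarrow> nat \<Rightarrow> 'c"
  assumes "\<And>i. i \<le> k \<Longrightarrow> inj_on (c i) {..k}" "n \<le> Suc k"
  shows "\<exists>g. length g = n \<and> set g \<subseteq> {..k} \<and> inj_on (\<lambda>i. c i (g ! i)) {..<n}"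
  using assms(2)
proof (induction n)
  case (Suc n)
  then obtain g where g: "length g = n" "set g \<subseteq> {..k}" "inj_on (\<lambda>i. c i (g ! i)) {..<n}"
    by auto
  let ?used = "(\<lambda>i. c i (g ! i)) ` {..<n}"
  have "card (c n ` {..k}) = Suc k"
    using assms(1)[of n] Suc.prems by (simp add: card_image)
  moreover have "card ?used \<le> n"
    using card_image_le[of "{..<n}"] by simp
  ultimately have "\<not> c n ` {..k} \<subseteq> ?used"
    using Suc.prems card_mono[of ?used "c n ` {..k}"] by fastforce
  then obtain j where j: "j \<le> k" "c n j \<notin> ?used"
    by blast
  have "inj_on (\<lambda>i. c i ((g @ [j]) ! i)) {..<n}"
    using g(1,3) by (simp add: inj_on_def nth_append)
  moreover have "c n ((g @ [j]) ! n) \<notin> (\<lambda>i. c i ((g @ [j]) ! i)) ` {..<n}"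
    using g(1) j(2) by (auto simp: nth_append)
  ultimately have "inj_on (\<lambda>i. c i ((g @ [j]) ! i)) {..<Suc n}"
    by (simp add: lessThan_Suc)
  then show ?case
    using g j(1) by (intro exI[of _ "g @ [j]"]) simp
qed simp

text \<open>Counting the colours used by an arbitrary \<open>c\<close> lets the induction apply to
  the colouring that \<open>c\<close> induces on a copy.\<close>

lemma colours_level:
  assumes "\<And>a b. a \<in> level k \<Longrightarrow> b \<in> level k \<Longrightarrow> joined a b \<Longrightarrow> c a \<noteq> c b"
  shows "Suc k choose 2 \<le> card (c ` level k)"
  using assms
proof (induction k arbitrary: c)
  case (Suc k)
  have "inj_on (\<lambda>j. c (Tip k i j)) {..k}" if "i \<le> k" for i
    using that by (intro linorder_inj_onI Suc.prems) auto
  from rainbow_transversal[of k "\<lambda>i j. c (Tip k i j)", OF this order.refl]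
  obtain g where g: "length g = Suc k" "set g \<subseteq> {..k}"
      "inj_on (\<lambda>i. c (Tip k i (g ! i))) {..<Suc k}"
    by blast
  then have "g \<in> choices k"
    by (simp add: choices_def)
  then have Copy: "Copy g x \<in> level (Suc k)" if "x \<in> level k" for x
    using that by auto
  have Tip: "Tip k i (g ! i) \<in> level (Suc k)" if "i < Suc k" for i
    using that g(1) subsetD[OF g(2) nth_mem[of i]] by simp
  \<comment> \<open>The whole transversal is joined to the whole copy, hence \<open>?A\<close> and
    \<open>?B\<close> are disjoint.\<close>
  let ?A = "(\<lambda>i. c (Tip k i (g ! i))) ` {..<Suc k}" and ?B = "(\<lambda>x. c (Copy g x)) ` level k"
  have "Suc (Suc k) choose 2 = (Suc k choose 2) + Suc k"
    by (rule Suc_choose_2)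
  also have "\<dots> \<le> card ?B + card ?A"
    using Suc.IH[of "\<lambda>x. c (Copy g x)"] Suc.prems Copy g(3) by (fastforce simp: card_image)
  also have "\<dots> = card (?B \<union> ?A)"
    using Suc.prems[OF Tip Copy] finite_level
    by (intro card_Un_disjoint[symmetric]) (auto, metis)
  also have "\<dots> \<le> card (c ` level (Suc k))"
    using Tip Copy finite_level by (intro card_mono finite_imageI) blast+
  finally show ?case .
qed simp


section \<open>Clique number and chromatic number\<close>

theorem theorem2:
  fixes k :: nat
  assumes "k \<ge> 2"
  shows "\<exists>\<C> :: (real \<times> real) set set.
           finite \<C> \<and>
           (\<forall>C\<in>\<C>. grounded_x_monotone_curve C) \<and>
           clique_number \<C> (disjointness_edges \<C>) = k \<and>
           chromatic_number \<C> (disjointness_edges \<C>) = (k + 1) choose 2"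
proof -
  obtain F where inj: "inj_on F (level k)"
    and grounded: "\<And>v. v \<in> level k \<Longrightarrow> grounded_x_monotone_curve (F v)"
    and disjnt: "\<And>a b. a \<in> level k \<Longrightarrow> b \<in> level k \<Longrightarrow> a \<noteq> b \<Longrightarrow>
      disjnt (F a) (F b) \<longleftrightarrow> joined a b \<or> joined b a"
    by (rule curves_of_digraph[of "level k" joined pos len])
       (use finite_level joined_pos joined_trans_or in \<open>blast+\<close>)
  let ?C = "F ` level k"
  let ?E = "disjointness_edges ?C"
  note edge = edge_disjointness_image[OF inj _ _ disjnt]
  have "clique_number ?C ?E = k"
    unfolding clique_number_def
  proof (rule Max_eqI)
    have "{card K |K. K \<subseteq> ?C \<and> clique K ?E} \<subseteq> card ` Pow ?C"
      by blast
    then show "finite {card K |K. K \<subseteq> ?C \<and> clique K ?E}"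
      using finite_level by (meson finite_Pow_iff finite_imageI finite_subset)
  next
    fix n assume "n \<in> {card K |K. K \<subseteq> ?C \<and> clique K ?E}"
    then obtain K where K: "K \<subseteq> level k" "clique (F ` K) ?E" "n = card (F ` K)"
      by (auto simp: subset_image_iff)
    have "joined a b \<or> joined b a" if "a \<in> K" "b \<in> K" "a \<noteq> b" for a b
    proof -
      have ab: "a \<in> level k" "b \<in> level k"
        using K(1) that by auto
      then have "F a \<noteq> F b"
        using inj that(3) by (auto dest: inj_onD)
      then have "{F a, F b} \<in> ?E"
        using K(2) that unfolding clique_def by simp
      then show ?thesis
        using edge[OF ab] by simp
    qed
    then show "n \<le> k"
      using clique_level_card_le[OF K(1)] K(1,3) inj
      by (simp add: card_image inj_on_subset)
  next
    obtain K where K: "K \<subseteq> level k" "card K = k"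
      "\<And>a b. a \<in> K \<Longrightarrow> b \<in> K \<Longrightarrow> a \<noteq> b \<Longrightarrow> joined a b \<or> joined b a"
      using clique_level_exists[of k] by blast
    have "clique (F ` K) ?E"
      unfolding clique_def
    proof (intro ballI impI)
      fix A B assume "A \<in> F ` K" "B \<in> F ` K" "A \<noteq> B"
      then obtain a b where "a \<in> K" "b \<in> K" "A = F a" "B = F b" "a \<noteq> b"
        by auto
      then show "{A, B} \<in> ?E"
        using K(1,3) edge[of a b] by auto
    qed
    moreover have "card (F ` K) = k"
      using K(1,2) inj by (simp add: card_image inj_on_subset)
    ultimately show "k \<in> {card K |K. K \<subseteq> ?C \<and> clique K ?E}"
      using K(1) by blast
  qed
  moreover have "chromatic_number ?C ?E = (k + 1) choose 2"
    unfolding chromatic_number_def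
  proof (rule Least_equality)
    \<comment> \<open>The colouring of the vertices is carried over to curves by the inverse of
      \<open>F\<close>.\<close>
    let ?c = "\<lambda>C. colour (the_inv_into (level k) F C)"
    have "proper_colouring ?C ?E ?c"
      unfolding proper_colouring_def
    proof (intro ballI impI)
      fix A B assume "A \<in> ?C" "B \<in> ?C" "{A, B} \<in> ?E"
      then obtain a b where ab: "a \<in> level k" "b \<in> level k" "A = F a" "B = F b"
        by auto
      then have "joined a b \<or> joined b a"
        using edge[of a b] \<open>{A, B} \<in> ?E\<close> by simp
      then have "colour a \<noteq> colour b"
        using joined_colour[of a k b] joined_colour[of b k a] ab by auto
      then show "?c A \<noteq> ?c B"
        using inj ab by (simp add: the_inv_into_f_f)
    qed
    moreover have "?c ` ?C \<subseteq> {..<(k + 1) choose 2}"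
      using inj colour_less by (auto simp: the_inv_into_f_f)
    ultimately show "\<exists>c :: (real \<times> real) set \<Rightarrow> nat.
        c ` ?C \<subseteq> {..<(k + 1) choose 2} \<and> proper_colouring ?C ?E c"
      by blast
  next
    fix n assume "\<exists>c :: (real \<times> real) set \<Rightarrow> nat.
        c ` ?C \<subseteq> {..<n} \<and> proper_colouring ?C ?E c"
    then obtain c :: "(real \<times> real) set \<Rightarrow> nat"
      where c: "c ` ?C \<subseteq> {..<n}" "proper_colouring ?C ?E c"
      by blast
    have "c (F a) \<noteq> c (F b)" if "a \<in> level k" "b \<in> level k" "joined a b" for a b
    proof -
      have "{F a, F b} \<in> ?E"
        \<comment> \<open>\<open>joined_pos\<close> gives \<open>a \<noteq> b\<close>, which edges
          require.\<close>
        using that edge[of a b] joined_pos[OF that] by auto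
      then show ?thesis
        using c(2) that unfolding proper_colouring_def by simp
    qed
    then have "(k + 1) choose 2 \<le> card (c ` ?C)"
      using colours_level[of k "\<lambda>v. c (F v)"] by (simp add: image_image)
    also have "\<dots> \<le> n"
      using card_mono[OF _ c(1)] by simp
    finally show "(k + 1) choose 2 \<le> n" .
  qed
  ultimately show ?thesis
    using grounded finite_level by (intro exI[of _ ?C] conjI ballI) auto
qed

end
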